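(* Let $\mathbb{X}$ be a finite dimensional real Banach space and let $T, A \in \mathbb{L}(\mathbb{X})$. Then $T \perp_B A$ if and only if there exist $x, y \in M_T$ such that $Ax \in (Tx)^{+}$ and $Ay \in (Ty)^{-}$.
   Context: $\mathbb{L}(\mathbb{X})$ denotes the Banach space of all linear operators on $\mathbb{X}$ with the operator norm, and $S_{\mathbb{X}} = \{x \in \mathbb{X} : \|x\| = 1\}$. For elements $u, v$ of a real normed linear space (in particular for $u,v\in\mathbb{X}$ or $u,v\in\mathbb{L}(\mathbb{X})$), $u$ is Birkhoff-James orthogonal to $v$, written $u \perp_B v$, if $\|u\| \leq \|u + \lambda v\|$ for all $\lambda \in \mathbb{R}$. For $T \in \mathbb{L}(\mathbb{X})$, $M_T = \{x \in S_{\mathbb{X}} : \|Tx\| = \|T\|\}$. For $u, v$ in a real normed linear space, one writes $v \in u^{+}$ if $\|u + \lambda v\| \geq \|u\|$ for all $\lambda \geq 0$, and $v \in u^{-}$ if $\|u + \lambda v\| \geq \|u\|$ for all $\lambda \leq 0$.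
   Formalization: The space X is assumed to be nonzero; for X = {0} the unit sphere and hence M_T are empty while T ⊥_B A holds, so the equivalence fails there. *)

theory Defs
  imports "HOL-Analysis.Analysis"
begin

definition birkhoff_james_orthogonal :: "'a::real_normed_vector \<Rightarrow> 'a \<Rightarrow> bool"
    (infix \<open>\<bottom>\<^sub>B\<close> 50)
  where "u \<bottom>\<^sub>B v \<longleftrightarrow> (\<forall>c::real. norm u \<le> norm (u + c *\<^sub>R v))"

text \<open>On a finite-dimensional space every linear operator is bounded, so there the type of
  bounded linear operators, whose norm is the operator norm, is the space of all linear operators.\<close>

definition norm_attainment_set ::
    "('a::real_normed_vector \<Rightarrow>\<^sub>L 'b::real_normed_vector) \<Rightarrow> 'a set"
  where "norm_attainment_set T = {x \<in> sphere 0 1. norm (blinfun_apply T x) = norm T}"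

definition plus_set :: "'a::real_normed_vector \<Rightarrow> 'a set"
  where "plus_set u = {v. \<forall>c::real. c \<ge> 0 \<longrightarrow> norm (u + c *\<^sub>R v) \<ge> norm u}"

definition minus_set :: "'a::real_normed_vector \<Rightarrow> 'a set"
  where "minus_set u = {v. \<forall>c::real. c \<le> 0 \<longrightarrow> norm (u + c *\<^sub>R v) \<ge> norm u}"

text \<open>Unlike the classes of Euclidean spaces, whose norm comes from an inner product, this
  predicate leaves the norm arbitrary.\<close>

definition finite_dimensional :: "'a::real_vector itself \<Rightarrow> bool"
  where "finite_dimensional _ \<longleftrightarrow> (\<exists>B::'a set. finite B \<and> span B = UNIV)"

end

theory Submission
  imports Defs
begin

text \<open>The implication from right to left holds because \<open>\<parallel>T + cA\<parallel> \<ge> \<parallel>Tx + cAx\<parallel>\<close> for every unit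
  vector \<open>x\<close>: the point \<open>x\<close> handles \<open>c \<ge> 0\<close>, the point \<open>y\<close> handles \<open>c \<le> 0\<close>.

  For the converse, consider for \<open>c > 0\<close> the set \<open>K\<^sub>c\<close> of unit vectors \<open>x\<close> with
  \<open>\<parallel>Tx + cAx\<parallel> \<ge> \<parallel>T\<parallel>\<close>. In finite dimension the unit sphere is compact, so \<open>T + cA\<close> attains its
  norm, which is at least \<open>\<parallel>T\<parallel>\<close> by orthogonality; hence \<open>K\<^sub>c\<close> is nonempty and compact.
  The function \<open>c \<mapsto> \<parallel>Tx + cAx\<parallel>\<close> is convex and at most \<open>\<parallel>T\<parallel>\<close> at \<open>0\<close>, so once it
  has reached \<open>\<parallel>T\<parallel>\<close> it stays above: the sets \<open>K\<^sub>c\<close> shrink as \<open>c\<close> decreases to \<open>0\<close>. By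
  compactness they have a common point \<open>x\<close>. Letting \<open>c\<close> tend to \<open>0\<close> gives \<open>\<parallel>Tx\<parallel> = \<parallel>T\<parallel>\<close>,
  and then membership in all \<open>K\<^sub>c\<close> says that \<open>Ax \<in> (Tx)\<^sup>+\<close>. The point \<open>y\<close> comes from the same
  argument for \<open>-A\<close>.

  Compactness of balls in finite-dimensional subspaces is proved for an arbitrary norm, by
  adding one spanning vector at a time.\<close>

text \<open>A limit of a sequence in \<open>S\<close> is a limit within one ball, where compactness
  gives closedness.\<close>

lemma closed_if_compact_Int_cball:
  fixes S :: "'a::real_normed_vector set"
  assumes "\<And>r. compact (S \<inter> cball 0 r)"
  shows "closed S"
  unfolding closed_sequential_limits
proof (intro allI impI, elim conjE)
  fix x l
  assume x: "\<forall>n. x n \<in> S" and lim: "x \<longlonglongrightarrow> l"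
  obtain r where "\<forall>n. norm (x n) \<le> r"
    using convergent_imp_bounded[OF lim] by (auto simp: bounded_iff)
  then have "\<forall>n. x n \<in> S \<inter> cball 0 r"
    using x by simp
  moreover have "closed (S \<inter> cball 0 r)"
    by (simp add: assms compact_imp_closed)
  ultimately show "l \<in> S"
    using lim closed_sequentially by blast
qed

text \<open>If \<open>b\<close> lies outside the closed subspace \<open>span B\<close>, at distance \<open>d > 0\<close>, then
  \<open>\<parallel>v + tb\<parallel> \<ge> \<bar>t\<bar> d\<close> for \<open>v \<in> span B\<close>. A bound on \<open>v + tb\<close> therefore bounds both \<open>t\<close> and
  \<open>v\<close>, and the ball in the larger span is cut out of the continuous image of a compact product.\<close>

lemma compact_span_Int_cball:
  fixes B :: "'a::real_normed_vector set"
  assumes "finite B"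
  shows "compact (span B \<inter> cball 0 r)"
  using assms
proof (induction B arbitrary: r rule: finite_induct)
  case empty
  show ?case
    by (simp add: finite_imp_compact)
next
  case (insert b B)
  show ?case
  proof (cases "b \<in> span B")
    case True
    then show ?thesis
      using insert.IH by (simp add: span_redundant)
  next
    case False
    have closed: "closed (span B)"
      using insert.IH by (rule closed_if_compact_Int_cball)
    define d where "d = infdist b (span B)"
    have "d > 0"
      unfolding d_def using closed False span_zero[of B]
      by (intro infdist_pos_not_in_closed) auto
    have lower: "\<bar>t\<bar> * d \<le> norm (v + t *\<^sub>R b)" if "v \<in> span B" for v t
    proof (cases "t = 0")
      case nonzero: False
      have "(- inverse t) *\<^sub>R v \<in> span B"
        using that by (rule span_scale)
      then have "d \<le> dist b ((- inverse t) *\<^sub>R v)"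
        unfolding d_def by (rule infdist_le)
      then have "\<bar>t\<bar> * d \<le> \<bar>t\<bar> * norm (b + inverse t *\<^sub>R v)"
        by (intro mult_left_mono) (auto simp: dist_norm)
      also have "\<dots> = norm (t *\<^sub>R (b + inverse t *\<^sub>R v))"
        by simp
      also have "t *\<^sub>R (b + inverse t *\<^sub>R v) = v + t *\<^sub>R b"
        using nonzero by (simp add: scaleR_add_right)
      finally show ?thesis .
    qed simp
    define K where "K = (\<lambda>(v, t). v + t *\<^sub>R b) `
      ((span B \<inter> cball 0 (r + r / d * norm b)) \<times> {- (r / d)..r / d})"
    have "compact K"
      unfolding K_def case_prod_beta
      by (intro compact_continuous_image compact_Times insert.IH continuous_intros) auto
    have "K \<subseteq> span (insert b B)"
      unfolding K_def
      by (auto intro!: span_add span_scale span_base[of b] elim: span_mono[THEN subsetD, rotated])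
    moreover have "span (insert b B) \<inter> cball 0 r \<subseteq> K"
    proof
      fix x assume x: "x \<in> span (insert b B) \<inter> cball 0 r"
      then obtain t where t: "x - t *\<^sub>R b \<in> span B"
        by (auto simp: span_insert)
      have "\<bar>t\<bar> * d \<le> r"
        using lower[OF t, of t] x by simp
      then have t_bound: "\<bar>t\<bar> \<le> r / d"
        using \<open>d > 0\<close> by (simp add: field_simps)
      have "norm (x - t *\<^sub>R b) \<le> norm x + \<bar>t\<bar> * norm b"
        using norm_triangle_ineq4[of x "t *\<^sub>R b"] by simp
      also have "\<dots> \<le> r + r / d * norm b"
        using x t_bound by (intro add_mono mult_right_mono) auto
      finally have "(x - t *\<^sub>R b, t) \<in>
          (span B \<inter> cball 0 (r + r / d * norm b)) \<times> {- (r / d)..r / d}"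
        using t t_bound by auto
      then show "x \<in> K"
        unfolding K_def by (rule rev_image_eqI) simp
    qed
    ultimately have "span (insert b B) \<inter> cball 0 r = K \<inter> cball 0 r"
      by blast
    then show ?thesis
      using \<open>compact K\<close> by (simp add: compact_Int_closed)
  qed
qed

lemma compact_sphere_finite_dimensional:
  assumes "finite_dimensional TYPE('a::real_normed_vector)"
  shows "compact (sphere (0::'a) r)"
proof -
  obtain B :: "'a set" where "finite B" "span B = UNIV"
    using assms unfolding finite_dimensional_def by blast
  then have "compact (cball (0::'a) r)"
    using compact_span_Int_cball[of B r] by simp
  then have "compact (cball (0::'a) r - ball 0 r)"
    by (intro compact_diff open_ball)
  then show ?thesis
    by (simp add: cball_diff_eq_sphere)
qed

lemma norm_attainment_set_nonempty:
  fixes T :: "'a::real_normed_vector \<Rightarrow>\<^sub>L 'b::real_normed_vector"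
  assumes "compact (sphere (0::'a) 1)" and "\<exists>z::'a. z \<noteq> 0"
  shows "norm_attainment_set T \<noteq> {}"
proof -
  have "sphere (0::'a) 1 \<noteq> {}"
  proof -
    obtain z :: 'a where "z \<noteq> 0"
      using assms(2) by blast
    then have "sgn z \<in> sphere 0 1"
      by (simp add: norm_sgn)
    then show ?thesis
      by blast
  qed
  moreover have "continuous_on (sphere 0 1) (\<lambda>x. norm (T x))"
    by (intro continuous_intros)
  ultimately obtain x where x: "x \<in> sphere 0 1"
    and max: "\<And>y. y \<in> sphere 0 1 \<Longrightarrow> norm (T y) \<le> norm (T x)"
    using continuous_attains_sup[OF assms(1)] by blast
  have "norm (T y) \<le> norm (T x) * norm y" for y
  proof (cases "y = 0")
    case False
    then have "norm (T (sgn y)) \<le> norm (T x)"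
      by (intro max) (simp add: norm_sgn)
    then show ?thesis
      using False by (simp add: sgn_div_norm blinfun.scaleR_right field_simps)
  qed simp
  then have "norm T \<le> norm (T x)"
    by (intro norm_blinfun_bound) auto
  moreover have "norm (T x) \<le> norm T"
    using norm_blinfun[of T x] x by simp
  ultimately show ?thesis
    using x unfolding norm_attainment_set_def by auto
qed

text \<open>Convexity of \<open>c \<mapsto> \<parallel>u + cv\<parallel>\<close> along a ray: once the norm has climbed to a level
  \<open>m \<ge> \<parallel>u\<parallel>\<close>, it never drops below \<open>m\<close> again.\<close>

lemma norm_add_scaleR_ge_beyond:
  fixes u v :: "'a::real_normed_vector"
  assumes "0 < s" "s \<le> c" and "norm u \<le> m" "m \<le> norm (u + s *\<^sub>R v)"
  shows "m \<le> norm (u + c *\<^sub>R v)"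
proof -
  define a where "a = s / c"
  have a: "0 < a" "a \<le> 1" and s: "s = a * c"
    using assms by (auto simp: a_def)
  have "u + s *\<^sub>R v = (1 - a) *\<^sub>R u + a *\<^sub>R (u + c *\<^sub>R v)"
    by (simp add: s algebra_simps)
  then have "norm (u + s *\<^sub>R v) \<le> (1 - a) * norm u + a * norm (u + c *\<^sub>R v)"
    using a norm_triangle_ineq[of "(1 - a) *\<^sub>R u" "a *\<^sub>R (u + c *\<^sub>R v)"] by simp
  also have "\<dots> \<le> (1 - a) * m + a * norm (u + c *\<^sub>R v)"
    using a assms(3) by (intro add_mono mult_left_mono) auto
  finally have "a * m \<le> a * norm (u + c *\<^sub>R v)"
    using assms(4) by (simp add: algebra_simps)
  then show ?thesis
    using a by simp
qed

text \<open>The one-sided half of the theorem, where only nonnegative multiples of \<open>A\<close> are compared: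
  the nested compact sets of vectors on which \<open>T + cA\<close> has norm at least \<open>\<parallel>T\<parallel>\<close> have a common
  point.\<close>

lemma exists_norm_attainment_plus_set:
  fixes T A :: "'a::real_normed_vector \<Rightarrow>\<^sub>L 'b::real_normed_vector"
  assumes compact: "compact (sphere (0::'a) 1)" and nontrivial: "\<exists>z::'a. z \<noteq> 0"
    and orth: "\<And>c. c \<ge> 0 \<Longrightarrow> norm T \<le> norm (T + c *\<^sub>R A)"
  shows "\<exists>x\<in>norm_attainment_set T. A x \<in> plus_set (T x)"
proof -
  define K where "K c = {x \<in> sphere 0 1. norm T \<le> norm (T x + c *\<^sub>R A x)}" for c :: real
  have T_le: "norm (T x) \<le> norm T" if "x \<in> sphere 0 1" for x
    using norm_blinfun[of T x] that by simp
  have closed_K: "closed (K c)" for c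
    unfolding K_def Collect_conj_eq Collect_mem_eq
    by (intro closed_Int compact_imp_closed[OF compact] closed_Collect_le continuous_intros)
  have K_nonempty: "K c \<noteq> {}" if "c > 0" for c
  proof -
    obtain x where "x \<in> norm_attainment_set (T + c *\<^sub>R A)"
      using norm_attainment_set_nonempty[OF compact nontrivial] by blast
    then have "x \<in> K c"
      using orth[of c] that
      by (simp add: K_def norm_attainment_set_def blinfun.add_left blinfun.scaleR_left)
    then show ?thesis
      by blast
  qed
  have K_mono: "K s \<subseteq> K c" if "0 < s" "s \<le> c" for s c
    using norm_add_scaleR_ge_beyond[OF that] T_le by (auto simp: K_def)
  have "sphere 0 1 \<inter> (\<Inter>c\<in>{0<..}. K c) \<noteq> {}"
  proof (rule compact_imp_fip_image[OF compact closed_K])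
    fix I :: "real set"
    assume I: "finite I" "I \<subseteq> {0<..}"
    \<comment> \<open>The element \<open>1\<close> gives \<open>s\<close> a positive value when \<open>I\<close> is empty.\<close>
    define s where "s = Min (insert 1 I)"
    have "0 < s" and "\<forall>c\<in>I. s \<le> c"
      using I by (auto simp: s_def)
    then have "K s \<subseteq> sphere 0 1 \<inter> (\<Inter>c\<in>I. K c)"
      using K_mono by (auto simp: K_def)
    then show "sphere 0 1 \<inter> (\<Inter>c\<in>I. K c) \<noteq> {}"
      using K_nonempty[OF \<open>0 < s\<close>] by blast
  qed
  then obtain x where x: "x \<in> sphere 0 1" and "\<forall>c\<in>{0<..}. x \<in> K c"
    by blast
  then have ge: "norm T \<le> norm (T x + c *\<^sub>R A x)" if "c > 0" for c
    using that by (simp add: K_def)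
  have "((\<lambda>c. norm (T x + c *\<^sub>R A x)) \<longlongrightarrow> norm (T x + 0 *\<^sub>R A x)) (at_right 0)"
    by (intro tendsto_intros)
  moreover have "\<forall>\<^sub>F c in at_right 0. norm T \<le> norm (T x + c *\<^sub>R A x)"
    using ge by (auto simp: eventually_at_filter)
  ultimately have "norm T \<le> norm (T x + 0 *\<^sub>R A x)"
    by (rule tendsto_lowerbound) simp
  then have attained: "norm (T x) = norm T"
    using T_le[OF x] by simp
  have "norm (T x) \<le> norm (T x + c *\<^sub>R A x)" if "c \<ge> 0" for c
    using ge[of c] that attained by (cases "c = 0") auto
  then show ?thesis
    using x attained by (auto simp: norm_attainment_set_def plus_set_def)
qed

lemma uminus_mem_plus_set_iff: "- v \<in> plus_set u \<longleftrightarrow> v \<in> minus_set u"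
proof
  assume *: "- v \<in> plus_set u"
  show "v \<in> minus_set u"
    unfolding minus_set_def
  proof safe
    fix c :: real assume "c \<le> 0"
    then show "norm u \<le> norm (u + c *\<^sub>R v)"
      using *[unfolded plus_set_def, simplified, rule_format, of "- c"] by simp
  qed
next
  assume "v \<in> minus_set u"
  then show "- v \<in> plus_set u"
    by (auto simp: plus_set_def minus_set_def dest: spec[of _ "- _"])
qed

lemma norm_le_norm_add_scaleR_blinfun:
  fixes T A :: "'a::real_normed_vector \<Rightarrow>\<^sub>L 'b::real_normed_vector"
  assumes "x \<in> norm_attainment_set T" and "norm (T x) \<le> norm (T x + c *\<^sub>R A x)"
  shows "norm T \<le> norm (T + c *\<^sub>R A)"
  using assms norm_blinfun[of "T + c *\<^sub>R A" x]
  by (simp add: norm_attainment_set_def blinfun.add_left blinfun.scaleR_left)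

theorem theorem2p2:
  fixes T A :: "'a::banach \<Rightarrow>\<^sub>L 'a"
  assumes "finite_dimensional TYPE('a)"
    and "\<exists>z::'a. z \<noteq> 0"
  shows "T \<bottom>\<^sub>B A \<longleftrightarrow>
    (\<exists>x\<in>norm_attainment_set T. \<exists>y\<in>norm_attainment_set T.
      blinfun_apply A x \<in> plus_set (blinfun_apply T x) \<and>
      blinfun_apply A y \<in> minus_set (blinfun_apply T y))"
proof
  assume orth: "T \<bottom>\<^sub>B A"
  note sphere = compact_sphere_finite_dimensional[OF assms(1), of 1]
  have "\<exists>x\<in>norm_attainment_set T. A x \<in> plus_set (T x)"
    using orth
    by (intro exists_norm_attainment_plus_set sphere assms(2))
      (simp add: birkhoff_james_orthogonal_def)
  moreover have "norm T \<le> norm (T + c *\<^sub>R (- A))" for c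
    using orth[unfolded birkhoff_james_orthogonal_def, rule_format, of "- c"] by simp
  then have "\<exists>y\<in>norm_attainment_set T. (- A) y \<in> plus_set (T y)"
    by (intro exists_norm_attainment_plus_set sphere assms(2))
  then have "\<exists>y\<in>norm_attainment_set T. A y \<in> minus_set (T y)"
    by (simp add: blinfun.minus_left uminus_mem_plus_set_iff)
  ultimately show "\<exists>x\<in>norm_attainment_set T. \<exists>y\<in>norm_attainment_set T.
      A x \<in> plus_set (T x) \<and> A y \<in> minus_set (T y)"
    by blast
next
  assume "\<exists>x\<in>norm_attainment_set T. \<exists>y\<in>norm_attainment_set T.
      A x \<in> plus_set (T x) \<and> A y \<in> minus_set (T y)"
  then obtain x y where x: "x \<in> norm_attainment_set T" "A x \<in> plus_set (T x)"
    and y: "y \<in> norm_attainment_set T" "A y \<in> minus_set (T y)"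
    by blast
  have "norm T \<le> norm (T + c *\<^sub>R A)" for c
  proof (cases "c \<ge> 0")
    case True
    then show ?thesis
      using x by (intro norm_le_norm_add_scaleR_blinfun[of x]) (auto simp: plus_set_def)
  next
    case False
    then show ?thesis
      using y by (intro norm_le_norm_add_scaleR_blinfun[of y]) (auto simp: minus_set_def)
  qed
  then show "T \<bottom>\<^sub>B A"
    by (simp add: birkhoff_james_orthogonal_def)
qed

end
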